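(* Let $G$ be a ribbon graph, let $A\subseteq E(G)$, and let $A^c=E(G)\setminus A$. Then the partial dual $G^{A}$ is an even-face graph if and only if the partial dual $G^{A^c}$ is Eulerian.
   Context: Graphs are finite, not necessarily connected, and may have loops and multiple edges. Ribbon graph. A ribbon graph $G=(V(G),E(G))$ is a (possibly non-orientable) surface with boundary represented as the union of two sets of topological discs, a set $V(G)$ of vertices and a set $E(G)$ of edges, such that: the vertices and edges intersect in disjoint line segments (called common line segments); each such line segment lies on the boundary of precisely one vertex and precisely one edge; every edge contains exactly two such line segments. Ribbon graphs are equivalent to graphs cellularly embedded in closed surfaces (gluing a disc to each boundary component gives the surface; the glued discs are the faces). Ribbon graphs are considered up to equivalence of the corresponding cellularly embedded graphs (homeomorphism of surfaces carrying one graph to the other, orientation preserving when the surface is orientable). Line segments. Removing the two common line segments from the boundary of an edge disc leaves two disjoint segments, called edge line segments. Removing the common line segments from the boundary of a vertex disc leaves the vertex line segments. On each boundary component of $G$ vertex line segments and edge line segments alternate; the number of edge line segments on a boundary component is the degree of that boundary component (it equals the degree of the corresponding face). Even-face: a ribbon graph is even-face if each of its boundary components has even degree. Eulerian: a graph is Eulerian if every vertex has even degree (number of incident half-edges; connectedness is not required). Arrow presentation. An arrow presentation is a set of circles with labelled arrows (marking arrows) on them, exactly two arrows for each label. It determines a ribbon graph: each circle is the boundary of a vertex disc; for each label $e$ take an edge disc, orient its boundary, place two disjoint arrows on its boundary pointing in the direction of the orientation, and identify these with the two $e$-labelled arrows. Partial dual. Let $A\subseteq E(G)$. Arbitrarily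 orient (the boundary of) and label each edge disc of $G$. The boundary components of the spanning ribbon subgraph $(V(G),A)$ meet the edges of $G$ in disjoint arcs (for $e\in A$ these are the two edge line segments of $e$; for $e\notin A$ the two common line segments of $e$). On each of these arcs place an arrow pointing in the direction of the orientation of the edge boundary, labelled by the edge it meets. The boundary components of $(V(G),A)$ with these arrows form an arrow presentation, and the ribbon graph it determines is the partial dual $G^A$ of $G$ with respect to $A$. *)

theory Defs
  imports Main
begin

text \<open>
  A ribbon graph, up to equivalence, is determined by how its line segments are glued together.
  We record the finite set of end points of the common line segments.  Every such point is an end
  of exactly one common line segment, one edge line segment and one vertex line segment, so each
  of the three families of segments is a fixed-point free involution sending a point to the
  opposite end of the segment in question.  An isolated vertex carries no points.
\<close>

definition pairing_on :: "'p set \<Rightarrow> ('p \<Rightarrow> 'p) \<Rightarrow> bool" where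
  "pairing_on S f \<longleftrightarrow> (\<forall>x\<in>S. f x \<in> S \<and> f x \<noteq> x \<and> f (f x) = x)"

text \<open>The points met when walking from \<open>p\<close> along a closed curve made of segments of the two
  families \<open>f\<close> and \<open>g\<close>.\<close>

inductive_set circuit :: "('p \<Rightarrow> 'p) \<Rightarrow> ('p \<Rightarrow> 'p) \<Rightarrow> 'p \<Rightarrow> 'p set"
  for f g :: "'p \<Rightarrow> 'p" and p :: 'p
where
  start: "p \<in> circuit f g p"
| step1: "q \<in> circuit f g p \<Longrightarrow> f q \<in> circuit f g p"
| step2: "q \<in> circuit f g p \<Longrightarrow> g q \<in> circuit f g p"

definition segments :: "('p \<Rightarrow> 'p) \<Rightarrow> 'p set \<Rightarrow> 'p set set" where
  "segments f S = (\<lambda>p. {p, f p}) ` S"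

record ('v, 'e, 'p) ribbon =
  verts :: "'v set"
  edges :: "'e set"
  points :: "'p set"
  vert_of :: "'p \<Rightarrow> 'v"
  edge_of :: "'p \<Rightarrow> 'e"
  cseg :: "'p \<Rightarrow> 'p"  \<comment> \<open>common line segments\<close>
  eseg :: "'p \<Rightarrow> 'p"  \<comment> \<open>edge line segments\<close>
  vseg :: "'p \<Rightarrow> 'p"  \<comment> \<open>vertex line segments\<close>

definition vert_points :: "('v, 'e, 'p) ribbon \<Rightarrow> 'v \<Rightarrow> 'p set" where
  "vert_points G v = {p \<in> points G. vert_of G p = v}"

definition edge_points :: "('v, 'e, 'p) ribbon \<Rightarrow> 'e \<Rightarrow> 'p set" where
  "edge_points G e = {p \<in> points G. edge_of G p = e}"

text \<open>\<open>vertex_disc\<close> and \<open>edge_disc\<close> say that the boundary of each vertex (edge) is a single circle,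
  made of common line segments alternating with vertex (edge) line segments.\<close>

locale ribbon_graph =
  fixes G :: "('v, 'e, 'p) ribbon"
  assumes finite_verts: "finite (verts G)"
    and finite_edges: "finite (edges G)"
    and finite_points: "finite (points G)"
    and cseg: "pairing_on (points G) (cseg G)"
    and eseg: "pairing_on (points G) (eseg G)"
    and vseg: "pairing_on (points G) (vseg G)"
    and vert_of: "p \<in> points G \<Longrightarrow> vert_of G p \<in> verts G"
    and edge_of: "p \<in> points G \<Longrightarrow> edge_of G p \<in> edges G"
    and vertex_disc: "p \<in> points G \<Longrightarrow>
      vert_points G (vert_of G p) = circuit (cseg G) (vseg G) p"
    and edge_disc: "p \<in> points G \<Longrightarrow>
      edge_points G (edge_of G p) = circuit (cseg G) (eseg G) p"
    and two_common_segments: "e \<in> edges G \<Longrightarrow>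
      card (segments (cseg G) (edge_points G e)) = 2"

definition ribbon_equiv :: "('v, 'e, 'p) ribbon \<Rightarrow> ('w, 'f, 'q) ribbon \<Rightarrow> bool" where
  "ribbon_equiv G H \<longleftrightarrow> (\<exists>\<phi> \<psi> \<chi>.
     bij_betw \<phi> (verts G) (verts H) \<and>
     bij_betw \<psi> (edges G) (edges H) \<and>
     bij_betw \<chi> (points G) (points H) \<and>
     (\<forall>p\<in>points G.
        vert_of H (\<chi> p) = \<phi> (vert_of G p) \<and>
        edge_of H (\<chi> p) = \<psi> (edge_of G p) \<and>
        cseg H (\<chi> p) = \<chi> (cseg G p) \<and>
        eseg H (\<chi> p) = \<chi> (eseg G p) \<and>
        vseg H (\<chi> p) = \<chi> (vseg G p)))"

text \<open>
  The boundary components of the spanning ribbon subgraph with edge set \<open>A\<close>.  Where such a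
  component meets an edge of \<open>G\<close>, it runs along an edge line segment if the edge is in \<open>A\<close> and
  along a common line segment otherwise; between these arcs it runs along vertex line segments of
  \<open>G\<close>.  The boundary of an isolated vertex \<open>v\<close> of \<open>G\<close> meets no edge; it is represented by \<open>Inr v\<close>.
\<close>

definition arc :: "('v, 'e, 'p) ribbon \<Rightarrow> 'e set \<Rightarrow> 'p \<Rightarrow> 'p" where
  "arc G A p = (if edge_of G p \<in> A then eseg G p else cseg G p)"

definition boundary_through :: "('v, 'e, 'p) ribbon \<Rightarrow> 'e set \<Rightarrow> 'p \<Rightarrow> 'p set + 'v" where
  "boundary_through G A p = Inl (circuit (arc G A) (vseg G) p)"

definition boundary_components :: "('v, 'e, 'p) ribbon \<Rightarrow> 'e set \<Rightarrow> ('p set + 'v) set" where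
  "boundary_components G A =
     boundary_through G A ` points G \<union> Inr ` {v \<in> verts G. vert_points G v = {}}"

fun boundary_points :: "'p set + 'v \<Rightarrow> 'p set" where
  "boundary_points (Inl C) = C"
| "boundary_points (Inr v) = {}"

definition boundary_degree :: "('v, 'e, 'p) ribbon \<Rightarrow> 'p set + 'v \<Rightarrow> nat" where
  "boundary_degree G b = card (segments (eseg G) (boundary_points b))"

definition even_face :: "('v, 'e, 'p) ribbon \<Rightarrow> bool" where
  "even_face G \<longleftrightarrow> (\<forall>b \<in> boundary_components G (edges G). even (boundary_degree G b))"

text \<open>Half-edges at a vertex correspond to the common line segments on its boundary.\<close>

definition vertex_degree :: "('v, 'e, 'p) ribbon \<Rightarrow> 'v \<Rightarrow> nat" where
  "vertex_degree G v = card (segments (cseg G) (vert_points G v))"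

definition eulerian :: "('v, 'e, 'p) ribbon \<Rightarrow> bool" where
  "eulerian G \<longleftrightarrow> (\<forall>v \<in> verts G. even (vertex_degree G v))"

text \<open>
  In an arrow presentation, a labelled arrow is a triple \<open>(l, t, h)\<close> of label, tail and head, and
  \<open>gap\<close> sends an end of an arrow to the opposite end of the part of the circle that separates the
  arrow from its neighbour on that side.
\<close>

record ('c, 'e, 'p) arrows =
  circles :: "'c set"
  arrows :: "('e \<times> 'p \<times> 'p) set"
  gap :: "'p \<Rightarrow> 'p"
  circle_of :: "'p \<Rightarrow> 'c"

definition arrow_ends :: "('c, 'e, 'p) arrows \<Rightarrow> 'p set" where
  "arrow_ends P = (\<Union>(l, t, h) \<in> arrows P. {t, h})"

definition labels :: "('c, 'e, 'p) arrows \<Rightarrow> 'e set" where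
  "labels P = fst ` arrows P"

definition label_of :: "('c, 'e, 'p) arrows \<Rightarrow> 'p \<Rightarrow> 'e" where
  "label_of P p = (THE l. \<exists>q. (l, p, q) \<in> arrows P \<or> (l, q, p) \<in> arrows P)"

definition other_end :: "('c, 'e, 'p) arrows \<Rightarrow> 'p \<Rightarrow> 'p" where
  "other_end P p = (THE q. \<exists>l. (l, p, q) \<in> arrows P \<or> (l, q, p) \<in> arrows P)"

locale arrow_presentation =
  fixes P :: "('c, 'e, 'p) arrows"
  assumes finite_circles: "finite (circles P)"
    and finite_arrows: "finite (arrows P)"
    and tail_neq_head: "(l, t, h) \<in> arrows P \<Longrightarrow> t \<noteq> h"
    and disjoint_arrows: "(l, t, h) \<in> arrows P \<Longrightarrow> (l', t', h') \<in> arrows P \<Longrightarrow>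
      {t, h} \<inter> {t', h'} \<noteq> {} \<Longrightarrow> (l, t, h) = (l', t', h')"
    and two_arrows: "l \<in> labels P \<Longrightarrow> card {a \<in> arrows P. fst a = l} = 2"
    and gap: "pairing_on (arrow_ends P) (gap P)"
    and circle_of: "p \<in> arrow_ends P \<Longrightarrow> circle_of P p \<in> circles P"
    and circle: "p \<in> arrow_ends P \<Longrightarrow>
      {q \<in> arrow_ends P. circle_of P q = circle_of P p} = circuit (other_end P) (gap P) p"

text \<open>
  The boundary of the edge disc with label \<open>l\<close>, in the direction of its orientation, runs along one
  \<open>l\<close>-labelled arrow from tail to head, then along an edge line segment to the tail of the other
  \<open>l\<close>-labelled arrow, and so on.  Hence an edge line segment joins the head of one \<open>l\<close>-labelled
  arrow to the tail of the other.
\<close>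

definition across_edge :: "('c, 'e, 'p) arrows \<Rightarrow> 'p \<Rightarrow> 'p" where
  "across_edge P p = (THE q. \<exists>l t h t' h'. (l, t, h) \<in> arrows P \<and> (l, t', h') \<in> arrows P \<and>
     (t, h) \<noteq> (t', h') \<and> (p = h \<and> q = t' \<or> p = t \<and> q = h'))"

definition ribbon_of_arrows :: "('c, 'e, 'p) arrows \<Rightarrow> ('c, 'e, 'p) ribbon" where
  "ribbon_of_arrows P =
     \<lparr>verts = circles P, edges = labels P, points = arrow_ends P,
      vert_of = circle_of P, edge_of = label_of P,
      cseg = other_end P, eseg = across_edge P, vseg = gap P\<rparr>"

text \<open>An orientation of the boundary of every edge disc, given by the successor \<open>s p\<close> of each
  point \<open>p\<close> on it.\<close>

definition edge_orientation :: "('v, 'e, 'p) ribbon \<Rightarrow> ('p \<Rightarrow> 'p) \<Rightarrow> bool" where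
  "edge_orientation G s \<longleftrightarrow>
     (\<forall>p\<in>points G. (s p = cseg G p \<or> s p = eseg G p) \<and> s (s p) \<noteq> p)"

definition partial_dual_arrows ::
  "('v, 'e, 'p) ribbon \<Rightarrow> 'e set \<Rightarrow> ('p \<Rightarrow> 'p) \<Rightarrow> ('p set + 'v, 'e, 'p) arrows" where
  "partial_dual_arrows G A s =
     \<lparr>circles = boundary_components G A,
      arrows = {(edge_of G p, p, arc G A p) |p. p \<in> points G \<and> s p = arc G A p},
      gap = vseg G,
      circle_of = boundary_through G A\<rparr>"

definition is_partial_dual :: "('v, 'e, 'p) ribbon \<Rightarrow> 'e set \<Rightarrow> ('w, 'f, 'q) ribbon \<Rightarrow> bool" where
  "is_partial_dual G A H \<longleftrightarrow>
     (\<exists>s. edge_orientation G s \<and> ribbon_equiv (ribbon_of_arrows (partial_dual_arrows G A s)) H)"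

text \<open>
  Consistency of the definitions: an arrow presentation determines a ribbon graph, edge orientations
  exist, the data defining a partial dual form an arrow presentation, and so partial duals exist.
\<close>

lemma pairing_onD:
  assumes "pairing_on S f" "x \<in> S"
  shows "f x \<in> S" "f x \<noteq> x" "f (f x) = x"
  using assms by (auto simp: pairing_on_def)

lemma circuit_subset:
  assumes "pairing_on S f" "pairing_on S g" "p \<in> S"
  shows "circuit f g p \<subseteq> S"
proof
  fix q assume "q \<in> circuit f g p"
  then show "q \<in> S"
    by induction (use assms in \<open>auto simp: pairing_on_def\<close>)
qed

lemma circuit_trans:
  assumes "q \<in> circuit f g p" "r \<in> circuit f g q"
  shows "r \<in> circuit f g p"
  using assms(2,1) by induction (auto intro: circuit.intros)

lemma circuit_sym:
  assumes "pairing_on S f" "pairing_on S g" "p \<in> S" "q \<in> circuit f g p"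
  shows "p \<in> circuit f g q"
  using assms(4)
proof induction
  case start
  show ?case by (rule circuit.start)
next
  case (step1 q)
  have "q \<in> S" using circuit_subset[OF assms(1-3)] step1 by blast
  then have "q \<in> circuit f g (f q)"
    by (metis circuit.start circuit.step1 pairing_onD(3) assms(1))
  then show ?case using circuit_trans step1 by metis
next
  case (step2 q)
  have "q \<in> S" using circuit_subset[OF assms(1-3)] step2 by blast
  then have "q \<in> circuit f g (g q)"
    by (metis circuit.start circuit.step2 pairing_onD(3) assms(2))
  then show ?case using circuit_trans step2 by metis
qed

lemma circuit_eq_iff:
  assumes "pairing_on S f" "pairing_on S g" "p \<in> S" "q \<in> S"
  shows "circuit f g q = circuit f g p \<longleftrightarrow> q \<in> circuit f g p"
proof
  assume "circuit f g q = circuit f g p"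
  then show "q \<in> circuit f g p" using circuit.start by metis
next
  assume q: "q \<in> circuit f g p"
  then have "p \<in> circuit f g q" using circuit_sym assms by metis
  with q show "circuit f g q = circuit f g p" using circuit_trans by (metis subsetI subset_antisym)
qed

lemma circuit_cong:
  assumes "pairing_on S f" "pairing_on S g" "p \<in> S"
    "\<And>x. x \<in> S \<Longrightarrow> f' x = f x" "\<And>x. x \<in> S \<Longrightarrow> g' x = g x"
  shows "circuit f' g' p = circuit f g p"
proof (intro set_eqI iffI)
  fix q assume "q \<in> circuit f' g' p"
  then show "q \<in> circuit f g p"
    by induction (use circuit_subset[OF assms(1-3)] assms(4,5) in \<open>fastforce intro: circuit.intros\<close>)+
next
  have sub: "circuit f g p \<subseteq> S" by (rule circuit_subset[OF assms(1-3)])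
  fix q assume "q \<in> circuit f g p"
  then show "q \<in> circuit f' g' p"
  proof induction
    case start show ?case by (rule circuit.start)
  next
    case (step1 q)
    then have "f q = f' q" using sub assms(4) by auto
    then show ?case using step1 by (auto intro: circuit.intros)
  next
    case (step2 q)
    then have "g q = g' q" using sub assms(5) by auto
    then show ?case using step2 by (auto intro: circuit.intros)
  qed
qed

context ribbon_graph
begin

lemma edge_of_seg:
  assumes "p \<in> points G"
  shows "edge_of G (cseg G p) = edge_of G p" "edge_of G (eseg G p) = edge_of G p"
proof -
  have "cseg G p \<in> circuit (cseg G) (eseg G) p" "eseg G p \<in> circuit (cseg G) (eseg G) p"
    by (auto intro: circuit.intros)
  then show "edge_of G (cseg G p) = edge_of G p" "edge_of G (eseg G p) = edge_of G p"
    using edge_disc[OF assms] by (auto simp: edge_points_def)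
qed

lemma eseg_neq_cseg:
  assumes "p \<in> points G"
  shows "eseg G p \<noteq> cseg G p"
proof
  assume eq: "eseg G p = cseg G p"
  note c = pairing_onD[OF cseg assms] and e = pairing_onD[OF eseg assms]
  have "circuit (cseg G) (eseg G) p \<subseteq> {p, cseg G p}"
  proof
    fix q assume "q \<in> circuit (cseg G) (eseg G) p"
    then show "q \<in> {p, cseg G p}"
      by induction (use eq c e in auto)
  qed
  then have "segments (cseg G) (edge_points G (edge_of G p)) \<subseteq> {{p, cseg G p}}"
    using c by (auto simp: segments_def edge_disc[OF assms])
  then have "card (segments (cseg G) (edge_points G (edge_of G p))) \<le> 1"
    using card_mono[of "{{p, cseg G p}}"] by simp
  then show False using two_common_segments[OF edge_of[OF assms]] by simp
qed

lemma eseg_cseg_commute: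
  assumes p: "p \<in> points G"
  shows "eseg G (cseg G p) = cseg G (eseg G p)"
proof (rule ccontr)
  let ?c = "cseg G" and ?e = "eseg G"
  assume neq: "?e (?c p) \<noteq> ?c (?e p)"
  note c = pairing_onD[OF cseg] and e = pairing_onD[OF eseg]
  have pts: "?c p \<in> points G" "?e p \<in> points G" "?e (?c p) \<in> points G" using c e p by auto
  let ?X = "{{p, ?c p}, {?e p, ?c (?e p)}, {?e (?c p), ?c (?e (?c p))}}"
  have "{p, ?e p, ?e (?c p)} \<subseteq> circuit ?c ?e p" by (auto intro: circuit.intros)
  then have sub: "?X \<subseteq> segments ?c (edge_points G (edge_of G p))"
    by (auto simp: segments_def edge_disc[OF p])
  have 1: "?e p \<notin> {p, ?c p}" using e(2)[OF p] eseg_neq_cseg[OF p] by auto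
  have 2: "?e (?c p) \<notin> {p, ?c p}"
    using e(2,3) pts eseg_neq_cseg[OF p] by (metis insertE singletonD)
  have 3: "?e (?c p) \<notin> {?e p, ?c (?e p)}" using neq c(2) e(3) p pts by (metis insertE singletonD)
  have "{p, ?c p} \<noteq> {?e p, ?c (?e p)}" using 1 by blast
  moreover have "{?e (?c p), ?c (?e (?c p))} \<notin> {{p, ?c p}, {?e p, ?c (?e p)}}" using 2 3 by blast
  ultimately have "distinct [{p, ?c p}, {?e p, ?c (?e p)}, {?e (?c p), ?c (?e (?c p))}]" by force
  from distinct_card[OF this] have "card ?X = 3" by simp
  moreover have "finite (segments ?c (edge_points G (edge_of G p)))"
    using finite_points by (simp add: segments_def edge_points_def)
  ultimately show False
    using card_mono[OF _ sub] two_common_segments[OF edge_of[OF p]] by simp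
qed

lemma edge_points_eq:
  assumes p: "p \<in> points G"
  shows "edge_points G (edge_of G p) = {p, cseg G p, eseg G p, cseg G (eseg G p)}"
proof -
  note c = pairing_onD[OF cseg] and e = pairing_onD[OF eseg]
  have "circuit (cseg G) (eseg G) p \<subseteq> {p, cseg G p, eseg G p, cseg G (eseg G p)}"
  proof
    fix q assume "q \<in> circuit (cseg G) (eseg G) p"
    then show "q \<in> {p, cseg G p, eseg G p, cseg G (eseg G p)}"
      by induction (use c e p eseg_cseg_commute in \<open>auto; metis\<close>)+
  qed
  moreover have "{p, cseg G p, eseg G p, cseg G (eseg G p)} \<subseteq> circuit (cseg G) (eseg G) p"
    by (auto intro: circuit.intros)
  ultimately show ?thesis using edge_disc[OF p] by blast
qed

lemma edge_orientation_exists: "\<exists>s. edge_orientation G s"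
proof -
  let ?c = "cseg G" and ?e = "eseg G"
  note c = pairing_onD[OF cseg] and e = pairing_onD[OF eseg]
  define b where "b l = (SOME p. p \<in> edge_points G l)" for l
  define s where "s p = (if p = b (edge_of G p) \<or> p = ?c (?e (b (edge_of G p))) then ?c p else ?e p)" for p
  have "s (s p) \<noteq> p" if p: "p \<in> points G" for p
  proof -
    define q where "q = b (edge_of G p)"
    have "p \<in> edge_points G (edge_of G p)" using p by (simp add: edge_points_def)
    then have "q \<in> edge_points G (edge_of G p)" unfolding q_def b_def by (rule someI)
    then have q: "q \<in> points G" "edge_of G q = edge_of G p" by (auto simp: edge_points_def)
    have s: "s x = (if x = q \<or> x = ?c (?e q) then ?c x else ?e x)" if "edge_of G x = edge_of G p" for x
      using that by (simp add: s_def q_def)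
    have px: "p \<in> {q, ?c q, ?e q, ?c (?e q)}"
      using p edge_points_eq[OF q(1)] q(2) by (auto simp: edge_points_def)
    have sp: "edge_of G (s p) = edge_of G p" using edge_of_seg[OF p] by (simp add: s[OF refl])
    show ?thesis
      unfolding s[OF sp] unfolding s[OF refl]
      using px c e q(1) eseg_neq_cseg[OF q(1)] eseg_cseg_commute[OF q(1)]
        eseg_neq_cseg[OF e(1)[OF q(1)]]
      by (smt (verit) insertE singletonD)
  qed
  then have "edge_orientation G s" by (auto simp: edge_orientation_def s_def)
  then show ?thesis by blast
qed

lemma arc:
  assumes "p \<in> points G"
  shows "arc G A p \<in> points G" "arc G A p \<noteq> p" "arc G A (arc G A p) = p"
    "edge_of G (arc G A p) = edge_of G p"
  using pairing_onD[OF cseg assms] pairing_onD[OF eseg assms] edge_of_seg[OF assms]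
  by (auto simp: arc_def)

lemma pairing_arc: "pairing_on (points G) (arc G A)"
  by (auto simp: pairing_on_def arc)

end

locale oriented_ribbon_graph = ribbon_graph G for G :: "('v, 'e, 'p) ribbon" +
  fixes s :: "'p \<Rightarrow> 'p" and A :: "'e set"
  assumes orientation: "edge_orientation G s"
begin

text \<open>The common and the edge line segments of the partial dual.\<close>

definition "a = arc G A"
definition "a' = arc G (- A)"

abbreviation "PD \<equiv> partial_dual_arrows G A s"

lemma a: "p \<in> points G \<Longrightarrow> a p \<in> points G" "p \<in> points G \<Longrightarrow> a p \<noteq> p"
    "p \<in> points G \<Longrightarrow> a (a p) = p" "p \<in> points G \<Longrightarrow> edge_of G (a p) = edge_of G p"
  by (auto simp: a_def arc)

lemma a': "p \<in> points G \<Longrightarrow> a' p \<in> points G" "p \<in> points G \<Longrightarrow> a' p \<noteq> p"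
    "p \<in> points G \<Longrightarrow> a' (a' p) = p" "p \<in> points G \<Longrightarrow> edge_of G (a' p) = edge_of G p"
  by (auto simp: a'_def arc)

lemma aa': "p \<in> points G \<Longrightarrow> a p \<noteq> a' p" "p \<in> points G \<Longrightarrow> a (a' p) = a' (a p)"
  using eseg_neq_cseg[of p] eseg_cseg_commute[of p] edge_of_seg
  by (auto simp: a_def a'_def arc_def)

lemma edge_points_a:
  "p \<in> points G \<Longrightarrow> edge_points G (edge_of G p) = {p, a p, a' p, a' (a p)}"
  using edge_points_eq[of p] eseg_cseg_commute[of p] edge_of_seg by (auto simp: a_def a'_def arc_def)

lemma s_cases: "p \<in> points G \<Longrightarrow> s p = a p \<or> s p = a' p"
  using orientation by (auto simp: edge_orientation_def a_def a'_def arc_def)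

lemma s_s: "p \<in> points G \<Longrightarrow> s (s p) \<noteq> p"
  using orientation by (auto simp: edge_orientation_def)

lemma s_a: "p \<in> points G \<Longrightarrow> s (a p) = a (a p) \<longleftrightarrow> s p \<noteq> a p"
  by (smt (verit) s_cases s_s a a' aa')

lemma s_a': "p \<in> points G \<Longrightarrow> s (a' p) = a (a' p) \<longleftrightarrow> s p \<noteq> a p"
  by (smt (verit) s_cases s_s a a' aa')

lemma in_arrows:
  "(l, t, h) \<in> arrows PD \<longleftrightarrow> t \<in> points G \<and> l = edge_of G t \<and> h = a t \<and> s t = a t"
  by (auto simp: partial_dual_arrows_def a_def)

lemma arrow_ends: "arrow_ends PD = points G"
proof (intro set_eqI iffI)
  fix p assume "p \<in> arrow_ends PD"
  then show "p \<in> points G" by (auto simp: arrow_ends_def in_arrows a)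
next
  fix p assume p: "p \<in> points G"
  then have "(edge_of G p, p, a p) \<in> arrows PD \<or> (edge_of G p, a p, p) \<in> arrows PD"
    using s_a by (auto simp: in_arrows a)
  then show "p \<in> arrow_ends PD" unfolding arrow_ends_def by fastforce
qed

lemma incident:
  assumes "p \<in> points G"
  shows "(l, p, q) \<in> arrows PD \<or> (l, q, p) \<in> arrows PD \<longleftrightarrow> l = edge_of G p \<and> q = a p"
  using assms s_a[OF assms] by (auto simp: in_arrows a)

lemma label_of: "p \<in> points G \<Longrightarrow> label_of PD p = edge_of G p"
  by (simp add: label_of_def incident)

lemma other_end: "p \<in> points G \<Longrightarrow> other_end PD p = a p"
  by (simp add: other_end_def incident)

lemma across_edge:
  assumes p: "p \<in> points G"
  shows "across_edge PD p = a' p"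
  unfolding across_edge_def
proof (rule the_equality)
  have p': "a' p \<in> points G" using a' p by blast
  show "\<exists>l t h t' h'. (l, t, h) \<in> arrows PD \<and> (l, t', h') \<in> arrows PD \<and>
     (t, h) \<noteq> (t', h') \<and> (p = h \<and> a' p = t' \<or> p = t \<and> a' p = h')"
  proof (cases "s p = a p")
    case True
    then have "(edge_of G p, p, a p) \<in> arrows PD" using p by (simp add: in_arrows)
    moreover have "(edge_of G p, a (a' p), a' p) \<in> arrows PD"
      using p p' True s_a'[OF p] s_a[OF p'] by (simp add: in_arrows a a')
    moreover have "(p, a p) \<noteq> (a (a' p), a' p)" using aa'(1)[OF p] by simp
    ultimately show ?thesis by blast
  next
    case False
    then have "(edge_of G p, a p, p) \<in> arrows PD" using p s_a by (simp add: in_arrows a)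
    moreover have "(edge_of G p, a' p, a (a' p)) \<in> arrows PD"
      using p p' False s_a'[OF p] by (simp add: in_arrows a')
    moreover have "(a p, p) \<noteq> (a' p, a (a' p))" using aa'(1)[OF p] by simp
    ultimately show ?thesis by blast
  qed
next
  fix q
  assume "\<exists>l t h t' h'. (l, t, h) \<in> arrows PD \<and> (l, t', h') \<in> arrows PD \<and>
     (t, h) \<noteq> (t', h') \<and> (p = h \<and> q = t' \<or> p = t \<and> q = h')"
  then obtain t t' where t: "t \<in> points G" "t' \<in> points G" "edge_of G t' = edge_of G t"
    "s t = a t" "s t' = a t'" "t \<noteq> t'" "p = a t \<and> q = t' \<or> p = t \<and> q = a t'"
    by (auto simp: in_arrows)
  have "t' \<in> {t, a t, a' t, a' (a t)}"
    using t edge_points_a[OF t(1)] by (auto simp: edge_points_def)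
  then have "t' = a' (a t)"
    using t s_a[OF t(1)] s_a'[OF t(1)] by auto
  then show "q = a' p" using t(1,7) a a' aa' by auto
qed

lemma labels: "labels PD = edges G"
proof (intro set_eqI iffI)
  fix l assume "l \<in> labels PD"
  then show "l \<in> edges G" using edge_of by (auto simp: labels_def in_arrows)
next
  fix l assume l: "l \<in> edges G"
  have "edge_points G l \<noteq> {}" using two_common_segments[OF l] by (auto simp: segments_def)
  then obtain p where "p \<in> points G" "edge_of G p = l" by (auto simp: edge_points_def)
  then have "(l, p, a p) \<in> arrows PD \<or> (l, a p, p) \<in> arrows PD" using incident by blast
  then show "l \<in> labels PD" unfolding labels_def by force
qed

lemma arrow_presentation_PD: "arrow_presentation PD"
proof
  show "finite (circles PD)"
    using finite_points finite_verts by (simp add: partial_dual_arrows_def boundary_components_def)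
  show "finite (arrows PD)"
    using finite_points by (simp add: partial_dual_arrows_def)
  show "t \<noteq> h" if "(l, t, h) \<in> arrows PD" for l t h
    using that a(2) by (metis in_arrows)
  show "(l, t, h) = (l', t', h')"
    if "(l, t, h) \<in> arrows PD" "(l', t', h') \<in> arrows PD" "{t, h} \<inter> {t', h'} \<noteq> {}" for l t h l' t' h'
  proof -
    have t: "t \<in> points G" "t' \<in> points G" "s t = a t" "s t' = a t'" "h = a t" "h' = a t'"
      "l = edge_of G t" "l' = edge_of G t'"
      using that(1,2) by (auto simp: in_arrows)
    have "t = t'" using that(3) t s_a a by (smt (verit) disjoint_iff insertE singletonD)
    then show ?thesis using t by simp
  qed
  show "card {x \<in> arrows PD. fst x = l} = 2" if l: "l \<in> labels PD" for l
  proof -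
    obtain t where t: "t \<in> points G" "s t = a t" "edge_of G t = l"
      using l by (auto simp: labels_def in_arrows)
    let ?u = "a' (a t)"
    have u: "?u \<in> points G" "s ?u = a ?u" "edge_of G ?u = l" "?u \<noteq> t"
      using t a a' aa' s_a s_a' by (auto; metis)+
    have "{x \<in> arrows PD. fst x = l} = {(l, t, a t), (l, ?u, a ?u)}"
    proof (intro set_eqI iffI)
      fix x assume "x \<in> {x \<in> arrows PD. fst x = l}"
      then obtain r where r: "x = (l, r, a r)" "r \<in> points G" "edge_of G r = l" "s r = a r"
        by (cases x) (auto simp: in_arrows)
      then have "r \<in> {t, a t, a' t, a' (a t)}"
        using t edge_points_a[OF t(1)] by (auto simp: edge_points_def)
      then have "r = t \<or> r = ?u" using r t s_a[OF t(1)] s_a'[OF t(1)] by auto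
      then show "x \<in> {(l, t, a t), (l, ?u, a ?u)}" using r by auto
    qed (use t u in \<open>auto simp: in_arrows\<close>)
    then show ?thesis using u(4) by auto
  qed
  show "pairing_on (arrow_ends PD) (gap PD)"
    unfolding arrow_ends by (simp add: partial_dual_arrows_def vseg)
  show "circle_of PD p \<in> circles PD" if "p \<in> arrow_ends PD" for p
    using that unfolding arrow_ends by (simp add: partial_dual_arrows_def boundary_components_def)
  show "{q \<in> arrow_ends PD. circle_of PD q = circle_of PD p} = circuit (other_end PD) (gap PD) p"
    if "p \<in> arrow_ends PD" for p
  proof -
    have p: "p \<in> points G" using that arrow_ends by simp
    have "circuit (other_end PD) (gap PD) p = circuit (arc G A) (vseg G) p"
      by (rule circuit_cong[OF pairing_arc vseg p])
        (auto simp: other_end a_def, simp add: partial_dual_arrows_def)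
    then show ?thesis
      using circuit_eq_iff[OF pairing_arc vseg p, of _ A] circuit_subset[OF pairing_arc vseg p, of A]
      unfolding arrow_ends by (auto simp: partial_dual_arrows_def boundary_through_def)
  qed
qed

end

lemma (in arrow_presentation) ribbon_graph_of_arrows: "ribbon_graph (ribbon_of_arrows P)"
proof -
  let ?R = "ribbon_of_arrows P"
  have R: "verts ?R = circles P" "edges ?R = labels P" "points ?R = arrow_ends P"
      "vert_of ?R = circle_of P" "edge_of ?R = label_of P"
      "cseg ?R = other_end P" "eseg ?R = across_edge P" "vseg ?R = gap P"
    by (simp_all add: ribbon_of_arrows_def)
  have inc: "label_of P t = l" "label_of P h = l" "other_end P t = h" "other_end P h = t"
    "t \<in> arrow_ends P" "h \<in> arrow_ends P"
    if "(l, t, h) \<in> arrows P" for l t h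
  proof -
    have t: "(l', t, q) \<in> arrows P \<or> (l', q, t) \<in> arrows P \<longleftrightarrow> l' = l \<and> q = h" for l' q
      using disjoint_arrows[OF that, of l' t q] disjoint_arrows[OF that, of l' q t]
        that tail_neq_head[OF that] by auto
    have h: "(l', h, q) \<in> arrows P \<or> (l', q, h) \<in> arrows P \<longleftrightarrow> l' = l \<and> q = t" for l' q
      using disjoint_arrows[OF that, of l' h q] disjoint_arrows[OF that, of l' q h]
        that tail_neq_head[OF that] by auto
    show "label_of P t = l" "label_of P h = l" "other_end P t = h" "other_end P h = t"
      by (simp_all add: label_of_def other_end_def t h)
    show "t \<in> arrow_ends P" "h \<in> arrow_ends P" using that by (force simp: arrow_ends_def)+
  qed
  have acr: "across_edge P t = h'" "across_edge P h = t'"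
    if tt: "(l, t, h) \<in> arrows P" "(l, t', h') \<in> arrows P" "(t, h) \<noteq> (t', h')" for l t h t' h'
  proof -
    have two: "x = (l, t, h) \<or> x = (l, t', h')" if "x \<in> arrows P" "fst x = l" for x
    proof (rule ccontr)
      assume "\<not> ?thesis"
      then have "card {(l, t, h), (l, t', h'), x} = 3" using tt(3) by auto
      moreover have "card {(l, t, h), (l, t', h'), x} \<le> card {a \<in> arrows P. fst a = l}"
        using that tt finite_arrows by (intro card_mono) auto
      moreover have "l \<in> labels P" using tt(1) by (force simp: labels_def)
      ultimately show False using two_arrows[of l] by simp
    qed
    have neq: "t \<noteq> h" "t' \<noteq> h'" using tail_neq_head tt by auto
    have t: "q = h'" if "(k, u, v) \<in> arrows P" "(k, u', v') \<in> arrows P" "(u, v) \<noteq> (u', v')"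
      "t = v \<and> q = u' \<or> t = u \<and> q = v'" for q k u v u' v'
    proof -
      have "(k, u, v) = (l, t, h)" using disjoint_arrows[OF that(1) tt(1)] that(4) by auto
      then show ?thesis using two[OF that(2)] that neq by auto
    qed
    have h: "q = t'" if "(k, u, v) \<in> arrows P" "(k, u', v') \<in> arrows P" "(u, v) \<noteq> (u', v')"
      "h = v \<and> q = u' \<or> h = u \<and> q = v'" for q k u v u' v'
    proof -
      have "(k, u, v) = (l, t, h)" using disjoint_arrows[OF that(1) tt(1)] that(4) by auto
      then show ?thesis using two[OF that(2)] that neq by auto
    qed
    show "across_edge P t = h'"
      unfolding across_edge_def by (rule the_equality) (use tt t in blast)+
    show "across_edge P h = t'"
      unfolding across_edge_def by (rule the_equality) (use tt h in blast)+
  qed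
  have edge: "\<exists>t h t' h'. (l, t, h) \<in> arrows P \<and> (l, t', h') \<in> arrows P \<and> (t, h) \<noteq> (t', h') \<and>
      edge_points ?R l = {t, h, t', h'} \<and> {t, h} \<inter> {t', h'} = {}" if l: "l \<in> labels P" for l
  proof -
    obtain x y where xy: "{a \<in> arrows P. fst a = l} = {x, y}" "x \<noteq> y"
      using two_arrows[OF l] by (auto simp: card_2_iff)
    have "fst x = l" "fst y = l" using xy(1) by blast+
    then obtain t h t' h' where x: "x = (l, t, h)" and y: "y = (l, t', h')" by (cases x, cases y) auto
    have A: "(l, t, h) \<in> arrows P" "(l, t', h') \<in> arrows P" "(t, h) \<noteq> (t', h')"
      using xy x y by auto
    have "edge_points ?R l = {t, h, t', h'}"
    proof (intro set_eqI iffI)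
      fix p assume "p \<in> edge_points ?R l"
      then have p: "p \<in> arrow_ends P" "label_of P p = l" by (simp_all add: edge_points_def R)
      from p(1) obtain k u v where k: "(k, u, v) \<in> arrows P" "p = u \<or> p = v"
        unfolding arrow_ends_def by blast
      then have "k = l" using inc(1,2)[OF k(1)] p(2) by metis
      then have "(l, u, v) \<in> {a \<in> arrows P. fst a = l}" using k(1) by simp
      then have "(l, u, v) \<in> {x, y}" by (simp only: xy(1))
      then show "p \<in> {t, h, t', h'}" using k(2) x y by auto
    qed (use inc[OF A(1)] inc[OF A(2)] in \<open>auto simp: edge_points_def R\<close>)
    then show ?thesis using A disjoint_arrows[OF A(1,2)] by blast
  qed
  have lab: "label_of P p \<in> labels P" if p: "p \<in> arrow_ends P" for p
  proof -
    obtain l u v where k: "(l, u, v) \<in> arrows P" "p = u \<or> p = v"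
      using p unfolding arrow_ends_def by blast
    have "label_of P p = l" using inc(1,2)[OF k(1)] k(2) by metis
    then show ?thesis using k(1) by (force simp: labels_def)
  qed
  have pt: "\<exists>l t h t' h'. label_of P p = l \<and> (l, t, h) \<in> arrows P \<and> (l, t', h') \<in> arrows P \<and>
      (t, h) \<noteq> (t', h') \<and> edge_points ?R l = {t, h, t', h'} \<and> {t, h} \<inter> {t', h'} = {} \<and>
      p \<in> {t, h}" if p: "p \<in> arrow_ends P" for p
  proof -
    obtain t h t' h' where *: "(label_of P p, t, h) \<in> arrows P" "(label_of P p, t', h') \<in> arrows P"
      "(t, h) \<noteq> (t', h')" "edge_points ?R (label_of P p) = {t, h, t', h'}" "{t, h} \<inter> {t', h'} = {}"
      using edge[OF lab[OF p]] by blast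
    have "p \<in> {t, h, t', h'}" using p *(4) by (auto simp: edge_points_def R)
    then consider "p \<in> {t, h}" | "p \<in> {t', h'}" by blast
    then show ?thesis
    proof cases
      case 1 then show ?thesis using * by blast
    next
      case 2
      have "edge_points ?R (label_of P p) = {t', h', t, h}" using *(4) by auto
      then show ?thesis using * 2 by (metis inf_commute)
    qed
  qed
  show ?thesis
  proof
    show "finite (verts ?R)" "finite (edges ?R)" "finite (points ?R)"
      using finite_circles finite_arrows by (auto simp: R labels_def arrow_ends_def)
    show "pairing_on (points ?R) (cseg ?R)"
      unfolding pairing_on_def R
    proof
      fix p assume "p \<in> arrow_ends P"
      then obtain l t h where th: "(l, t, h) \<in> arrows P" "p \<in> {t, h}" using pt by metis
      then show "other_end P p \<in> arrow_ends P \<and> other_end P p \<noteq> p \<and> other_end P (other_end P p) = p"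
        using inc[OF th(1)] tail_neq_head[OF th(1)] by auto
    qed
    show "pairing_on (points ?R) (eseg ?R)"
      unfolding pairing_on_def R
    proof
      fix p assume "p \<in> arrow_ends P"
      from pt[OF this] obtain l t h t' h' where th: "label_of P p = l"
        "(l, t, h) \<in> arrows P" "(l, t', h') \<in> arrows P" "(t, h) \<noteq> (t', h')"
        "edge_points ?R l = {t, h, t', h'}" "{t, h} \<inter> {t', h'} = {}" "p \<in> {t, h}"
        by (elim exE conjE)
      then show "across_edge P p \<in> arrow_ends P \<and> across_edge P p \<noteq> p \<and>
          across_edge P (across_edge P p) = p"
        using acr[OF th(2-4)] acr[OF th(3,2) th(4)[symmetric]] inc[OF th(3)] by auto
    qed
    show "pairing_on (points ?R) (vseg ?R)" using gap by (simp add: R)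
    show "vert_of ?R p \<in> verts ?R" if "p \<in> points ?R" for p
      using that circle_of by (simp add: R)
    show "edge_of ?R p \<in> edges ?R" if "p \<in> points ?R" for p
      using that lab by (simp add: R)
    show "vert_points ?R (vert_of ?R p) = circuit (cseg ?R) (vseg ?R) p" if "p \<in> points ?R" for p
      using that circle by (simp add: R vert_points_def)
    show "edge_points ?R (edge_of ?R p) = circuit (cseg ?R) (eseg ?R) p" if p: "p \<in> points ?R" for p
    proof -
      have "p \<in> arrow_ends P" using p by (simp add: R)
      from pt[OF this] obtain l t h t' h' where th: "label_of P p = l"
        "(l, t, h) \<in> arrows P" "(l, t', h') \<in> arrows P"
        "(t, h) \<noteq> (t', h')" "edge_points ?R l = {t, h, t', h'}" "{t, h} \<inter> {t', h'} = {}"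
        "p \<in> {t, h}"
        by (elim exE conjE)
      note i = inc[OF th(2)] inc[OF th(3)] acr[OF th(2-4)] acr[OF th(3,2) th(4)[symmetric]]
      let ?C = "circuit (other_end P) (across_edge P) p"
      have st: "q \<in> ?C \<Longrightarrow> other_end P q \<in> ?C" "q \<in> ?C \<Longrightarrow> across_edge P q \<in> ?C" for q
        by (auto intro: circuit.intros)
      have "p \<in> ?C" by (rule circuit.start)
      then have "{t, h} \<subseteq> ?C" using st(1)[of p] i th(7) by auto
      then have "{t, h, t', h'} \<subseteq> ?C" using st(2)[of t] st(2)[of h] i by auto
      moreover have "?C \<subseteq> {t, h, t', h'}"
      proof
        fix q assume "q \<in> ?C"
        then show "q \<in> {t, h, t', h'}" by induction (use i th(7) in auto)
      qed
      ultimately have "{t, h, t', h'} = ?C" by (rule subset_antisym)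
      then show ?thesis using th(1,5) by (simp add: R)
    qed
    show "card (segments (cseg ?R) (edge_points ?R e)) = 2" if "e \<in> edges ?R" for e
    proof -
      have "e \<in> labels P" using that by (simp add: R)
      from edge[OF this] obtain t h t' h' where th: "(e, t, h) \<in> arrows P" "(e, t', h') \<in> arrows P"
        "(t, h) \<noteq> (t', h')" "edge_points ?R e = {t, h, t', h'}" "{t, h} \<inter> {t', h'} = {}"
        by (elim exE conjE)
      have "segments (cseg ?R) (edge_points ?R e) = {{t, h}, {t', h'}}"
        using inc[OF th(1)] inc[OF th(2)] by (auto simp: segments_def th(4) R)
      moreover have "{t, h} \<noteq> {t', h'}" using th(5) by blast
      ultimately show ?thesis by simp
    qed
  qed
qed

lemma ribbon_equiv_refl: "ribbon_equiv G G"
  unfolding ribbon_equiv_def by (intro exI[of _ id]) simp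

theorem partial_dual_exists:
  fixes G :: "('v, 'e, 'p) ribbon"
  assumes "ribbon_graph G"
  shows "\<exists>H :: ('p set + 'v, 'e, 'p) ribbon. ribbon_graph H \<and> is_partial_dual G A H"
proof -
  interpret ribbon_graph G by fact
  obtain s where s: "edge_orientation G s" using edge_orientation_exists by blast
  then interpret oriented_ribbon_graph G s A by unfold_locales
  show ?thesis
    using arrow_presentation.ribbon_graph_of_arrows[OF arrow_presentation_PD] s ribbon_equiv_refl
    unfolding is_partial_dual_def by blast
qed

end

theory Submission
  imports Defs
begin

text \<open>
  At every edge, the partial dual with respect to \<open>A\<close> has the arcs of the boundary of
  \<open>(V(G), A)\<close> as common line segments and the other two segments of the edge disc as edge line
  segments.  The latter are exactly the arcs of the boundary of \<open>(V(G), A\<^sup>c)\<close>.  So the boundary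
  components of the partial dual with respect to \<open>A\<close> are, degrees included, the boundaries of the
  vertices of the partial dual with respect to \<open>A\<^sup>c\<close>.
\<close>

text \<open>A walk from \<open>p\<close> never leaves \<open>S\<close>, and on \<open>S\<close> the
  map \<chi> intertwines \<open>f\<close> with \<open>f'\<close> and \<open>g\<close> with
  \<open>g'\<close>, so it carries the walk step by step to the walk from
  \<open>\<chi> p\<close>.\<close>

lemma circuit_image:
  assumes "pairing_on S f" "pairing_on S g" "p \<in> S"
    and "\<And>x. x \<in> S \<Longrightarrow> f' (\<chi> x) = \<chi> (f x)" "\<And>x. x \<in> S \<Longrightarrow> g' (\<chi> x) = \<chi> (g x)"
  shows "circuit f' g' (\<chi> p) = \<chi> ` circuit f g p"
proof (intro subset_antisym subsetI)
  have S: "q \<in> S" if "q \<in> circuit f g p" for q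
    using circuit_subset[OF assms(1-3)] that by blast
  show "q \<in> \<chi> ` circuit f g p" if "q \<in> circuit f' g' (\<chi> p)" for q
    using that by induction (auto simp: S assms(4,5) intro: circuit.intros)
  have "\<chi> q \<in> circuit f' g' (\<chi> p)" if "q \<in> circuit f g p" for q
    using that
  proof induction
    case (step1 q)
    then show ?case using circuit.step1[OF step1.IH] by (simp add: S assms(4))
  next
    case (step2 q)
    then show ?case using circuit.step2[OF step2.IH] by (simp add: S assms(5))
  qed (rule circuit.start)
  then show "q \<in> circuit f' g' (\<chi> p)" if "q \<in> \<chi> ` circuit f g p" for q
    using that by blast
qed

lemma segments_cong: "(\<And>x. x \<in> C \<Longrightarrow> f x = g x) \<Longrightarrow> segments f C = segments g C"
  unfolding segments_def by (rule image_cong) auto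

text \<open>Segments are subsets of \<open>S\<close>, and a map injective on \<open>S\<close> is
  injective on subsets of \<open>S\<close>, so distinct segments keep distinct images.\<close>

lemma card_segments_image:
  assumes "pairing_on S f" "inj_on \<chi> S" "C \<subseteq> S"
    and "\<And>x. x \<in> S \<Longrightarrow> f' (\<chi> x) = \<chi> (f x)"
  shows "card (segments f' (\<chi> ` C)) = card (segments f C)"
proof -
  have "segments f' (\<chi> ` C) = (`) \<chi> ` segments f C"
    unfolding segments_def image_image
    by (rule image_cong) (use assms(3,4) in auto)
  moreover have "segments f C \<subseteq> Pow S"
    using assms(1,3) by (auto simp: segments_def pairing_on_def)
  then have "inj_on ((`) \<chi>) (segments f C)"
    using inj_on_image_Pow[OF assms(2)] inj_on_subset by blast
  ultimately show ?thesis by (simp add: card_image)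
qed

context ribbon_graph
begin

text \<open>The boundary of the whole ribbon graph alternates between edge and vertex line segments,
  so each component with points is an \<open>eseg\<close>-\<open>vseg\<close> circuit. The
  equivalence moves the count back to \<open>G\<close>, leaving a condition free of
  \<open>H\<close>.\<close>

lemma even_face_equiv_iff:
  assumes "ribbon_equiv G H"
  shows "even_face H \<longleftrightarrow>
    (\<forall>p\<in>points G. even (card (segments (eseg G) (circuit (eseg G) (vseg G) p))))"
proof -
  obtain \<phi> \<psi> \<chi> where eq: "bij_betw \<psi> (edges G) (edges H)" "bij_betw \<chi> (points G) (points H)"
    "\<And>p. p \<in> points G \<Longrightarrow> edge_of H (\<chi> p) = \<psi> (edge_of G p) \<and>
       eseg H (\<chi> p) = \<chi> (eseg G p) \<and> vseg H (\<chi> p) = \<chi> (vseg G p)"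
    using assms unfolding ribbon_equiv_def by metis
  have arc: "arc H (edges H) (\<chi> p) = \<chi> (eseg G p)" if "p \<in> points G" for p
    using that eq(3) edge_of bij_betwE[OF eq(1)] by (simp add: arc_def)
  have deg: "boundary_degree H (boundary_through H (edges H) (\<chi> p)) =
      card (segments (eseg G) (circuit (eseg G) (vseg G) p))" if p: "p \<in> points G" for p
  proof -
    have "circuit (arc H (edges H)) (vseg H) (\<chi> p) = \<chi> ` circuit (eseg G) (vseg G) p"
      by (rule circuit_image[OF eseg vseg p]) (use arc eq(3) in auto)
    then show ?thesis
      using card_segments_image[OF eseg bij_betw_imp_inj_on[OF eq(2)]
          circuit_subset[OF eseg vseg p], of "eseg H"] eq(3)
      by (simp add: boundary_degree_def boundary_through_def)
  qed
  \<comment> \<open>A component \<open>Inr v\<close> of an isolated vertex has degree 0, which is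
    even, so components through points suffice.\<close>
  have "even_face H \<longleftrightarrow>
      (\<forall>q\<in>points H. even (boundary_degree H (boundary_through H (edges H) q)))"
    by (auto simp: even_face_def boundary_components_def boundary_degree_def segments_def)
  also have "\<dots> \<longleftrightarrow> (\<forall>p\<in>points G. even (boundary_degree H (boundary_through H (edges H) (\<chi> p))))"
    unfolding bij_betw_imp_surj_on[OF eq(2), symmetric] by simp
  finally show ?thesis using deg by simp
qed

text \<open>By \<open>vertex_disc\<close> the boundary of a vertex with points is a
  \<open>cseg\<close>-\<open>vseg\<close> circuit, so vertices can be replaced by base points of
  circuits.\<close>

lemma eulerian_equiv_iff:
  assumes "ribbon_equiv G H"
  shows "eulerian H \<longleftrightarrow>
    (\<forall>p\<in>points G. even (card (segments (cseg G) (circuit (cseg G) (vseg G) p))))"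
proof -
  obtain \<phi> \<psi> \<chi> where eq: "bij_betw \<phi> (verts G) (verts H)" "bij_betw \<chi> (points G) (points H)"
    "\<And>p. p \<in> points G \<Longrightarrow> vert_of H (\<chi> p) = \<phi> (vert_of G p) \<and> cseg H (\<chi> p) = \<chi> (cseg G p)"
    using assms unfolding ribbon_equiv_def by metis
  have deg: "vertex_degree H (\<phi> v) = vertex_degree G v" if v: "v \<in> verts G" for v
  proof -
    have "vert_of H (\<chi> p) = \<phi> v \<longleftrightarrow> vert_of G p = v" if "p \<in> points G" for p
      using that v eq(3) inj_on_eq_iff[OF bij_betw_imp_inj_on[OF eq(1)] vert_of] by simp
    then have "vert_points H (\<phi> v) = \<chi> ` vert_points G v"
      unfolding vert_points_def bij_betw_imp_surj_on[OF eq(2), symmetric] by blast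
    moreover have "vert_points G v \<subseteq> points G" by (auto simp: vert_points_def)
    ultimately show ?thesis
      using card_segments_image[OF cseg bij_betw_imp_inj_on[OF eq(2)], of _ "cseg H"] eq(3)
      by (simp add: vertex_degree_def)
  qed
  have "eulerian H \<longleftrightarrow> (\<forall>v\<in>verts G. even (vertex_degree G v))"
    unfolding eulerian_def bij_betw_imp_surj_on[OF eq(1), symmetric] by (simp add: deg)
  \<comment> \<open>A vertex not of the form \<open>vert_of G p\<close> carries no points and has
    degree 0.\<close>
  also have "\<dots> \<longleftrightarrow> (\<forall>p\<in>points G. even (vertex_degree G (vert_of G p)))"
  proof (intro iffI ballI)
    fix v assume *: "\<forall>p\<in>points G. even (vertex_degree G (vert_of G p))" and "v \<in> verts G"
    show "even (vertex_degree G v)"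
    proof (cases "vert_points G v = {}")
      case True
      then show ?thesis by (simp add: vertex_degree_def segments_def)
    next
      case False
      then show ?thesis using * by (auto simp: vert_points_def)
    qed
  qed (use vert_of in blast)
  finally show ?thesis by (simp add: vertex_degree_def vertex_disc)
qed

end

text \<open>Arrows lie along the arcs for \<open>A\<close>, and \<open>across_edge\<close> joins
  their ends along the remaining two sides of the edge disc, the arcs for \<open>- A\<close>. The
  orientation \<open>s\<close> does not enter these formulas, so later criteria hold for every
  choice of it.\<close>

lemma (in oriented_ribbon_graph) partial_dual_simps:
  defines "R \<equiv> ribbon_of_arrows PD"
  shows "ribbon_graph R" "points R = points G" "vseg R = vseg G"
    and "\<And>p. p \<in> points G \<Longrightarrow> cseg R p = arc G A p"
    and "\<And>p. p \<in> points G \<Longrightarrow> eseg R p = arc G (- A) p"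
proof -
  show "ribbon_graph R"
    unfolding R_def by (rule arrow_presentation.ribbon_graph_of_arrows[OF arrow_presentation_PD])
  show "points R = points G" by (simp add: R_def ribbon_of_arrows_def arrow_ends)
  show "vseg R = vseg G" by (simp add: R_def ribbon_of_arrows_def partial_dual_arrows_def)
  show "cseg R p = arc G A p" if "p \<in> points G" for p
    using other_end[OF that] by (simp add: R_def ribbon_of_arrows_def a_def)
  show "eseg R p = arc G (- A) p" if "p \<in> points G" for p
    using across_edge[OF that] by (simp add: R_def ribbon_of_arrows_def a'_def)
qed

context ribbon_graph
begin

text \<open>Faces of the dual are circuits of its edge and vertex line segments; by
  \<open>partial_dual_simps\<close> the former are the arcs for the complement of
  \<open>A\<close>.\<close>

lemma even_face_partial_dual_iff:
  assumes "is_partial_dual G A H"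
  shows "even_face H \<longleftrightarrow> (\<forall>p\<in>points G.
    even (card (segments (arc G (- A)) (circuit (arc G (- A)) (vseg G) p))))"
proof -
  obtain s where s: "edge_orientation G s"
    and H: "ribbon_equiv (ribbon_of_arrows (partial_dual_arrows G A s)) H"
    using assms by (auto simp: is_partial_dual_def)
  interpret oriented_ribbon_graph G s A by unfold_locales (rule s)
  let ?R = "ribbon_of_arrows PD"
  note R = partial_dual_simps
  have "segments (eseg ?R) (circuit (eseg ?R) (vseg ?R) p) =
      segments (arc G (- A)) (circuit (arc G (- A)) (vseg G) p)" if p: "p \<in> points G" for p
  proof -
    have "circuit (eseg ?R) (vseg ?R) p = circuit (arc G (- A)) (vseg G) p"
      by (rule circuit_cong[OF pairing_arc vseg p]) (simp_all add: R)
    then show ?thesis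
      using circuit_subset[OF pairing_arc vseg p, of "- A"] R(5) by (auto intro!: segments_cong)
  qed
  then show ?thesis by (simp add: ribbon_graph.even_face_equiv_iff[OF R(1) H] R(2))
qed

text \<open>Here the common line segments of the dual matter, and these are the arcs for
  \<open>A\<close> itself.\<close>

lemma eulerian_partial_dual_iff:
  assumes "is_partial_dual G A H"
  shows "eulerian H \<longleftrightarrow> (\<forall>p\<in>points G.
    even (card (segments (arc G A) (circuit (arc G A) (vseg G) p))))"
proof -
  obtain s where s: "edge_orientation G s"
    and H: "ribbon_equiv (ribbon_of_arrows (partial_dual_arrows G A s)) H"
    using assms by (auto simp: is_partial_dual_def)
  interpret oriented_ribbon_graph G s A by unfold_locales (rule s)
  let ?R = "ribbon_of_arrows PD"
  note R = partial_dual_simps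
  have "segments (cseg ?R) (circuit (cseg ?R) (vseg ?R) p) =
      segments (arc G A) (circuit (arc G A) (vseg G) p)" if p: "p \<in> points G" for p
  proof -
    have "circuit (cseg ?R) (vseg ?R) p = circuit (arc G A) (vseg G) p"
      by (rule circuit_cong[OF pairing_arc vseg p]) (simp_all add: R)
    then show ?thesis
      using circuit_subset[OF pairing_arc vseg p, of A] R(4) by (auto intro!: segments_cong)
  qed
  then show ?thesis by (simp add: ribbon_graph.eulerian_equiv_iff[OF R(1) H] R(2))
qed

end

theorem theorem1p2:
  fixes G :: "('v, 'e, 'p) ribbon"
    and A :: "'e set"
    and GA :: "('v1, 'e1, 'p1) ribbon"
    and GAc :: "('v2, 'e2, 'p2) ribbon"
  assumes "ribbon_graph G"
    and "A \<subseteq> edges G"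
    and "is_partial_dual G A GA"
    and "is_partial_dual G (edges G - A) GAc"
  shows "even_face GA \<longleftrightarrow> eulerian GAc"
proof -
  interpret ribbon_graph G by fact
  \<comment> \<open>\<open>- A\<close> is the complement in the whole type; every point lies on an
    edge of \<open>G\<close>, so both complements select the same arcs.\<close>
  have arc: "arc G (- A) p = arc G (edges G - A) p" if "p \<in> points G" for p
    using edge_of[OF that] by (simp add: arc_def)
  have "segments (arc G (- A)) (circuit (arc G (- A)) (vseg G) p) =
      segments (arc G (edges G - A)) (circuit (arc G (edges G - A)) (vseg G) p)"
    if p: "p \<in> points G" for p
  proof -
    have "circuit (arc G (- A)) (vseg G) p = circuit (arc G (edges G - A)) (vseg G) p"
      by (rule circuit_cong[OF pairing_arc vseg p]) (simp_all add: arc)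
    then show ?thesis
      using circuit_subset[OF pairing_arc vseg p, of "edges G - A"] arc
      by (auto intro!: segments_cong)
  qed
  \<comment> \<open>Both criteria now count the same segments on the same circuits.\<close>
  then show ?thesis
    by (simp add: even_face_partial_dual_iff[OF assms(3)] eulerian_partial_dual_iff[OF assms(4)])
qed

end
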